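(* For every integer $n \geq 8$ with $n \neq 11$, Right wins the Forbidden Leaf Variant of the Mixed Deletion Game played on the path $P_n$ regardless of which player moves first.
   Context: The Classic Variant of the Mixed Deletion Game is a two-player combinatorial game between Left and Right played on a finite simple undirected graph; players alternate turns. On her turn Left deletes one vertex together with all edges incident to it; on his turn Right deletes one edge. The game ends when a deletion creates an isolated vertex (a vertex of degree $0$), and the player whose deletion created an isolated vertex loses; thus a legal move is a deletion which does not create an isolated vertex, and a player with no legal move loses. The Forbidden Leaf Variant has the same rules with the additional restriction that Left may not delete a leaf (a vertex of degree $1$). $P_n$ denotes the path graph on $n$ vertices. *)

theory Defs
  imports Main
begin

record 'a ugraph =
  verts :: "'a set"
  edges :: "'a set set"

definition finite_simple_graph :: "'a ugraph \<Rightarrow> bool" where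
  "finite_simple_graph G \<longleftrightarrow>
     finite (verts G) \<and> (\<forall>e \<in> edges G. e \<subseteq> verts G \<and> card e = 2)"

definition degree :: "'a ugraph \<Rightarrow> 'a \<Rightarrow> nat" where
  "degree G v = card {e \<in> edges G. v \<in> e}"

definition isolated :: "'a ugraph \<Rightarrow> 'a \<Rightarrow> bool" where
  "isolated G v \<longleftrightarrow> v \<in> verts G \<and> degree G v = 0"

definition leaf :: "'a ugraph \<Rightarrow> 'a \<Rightarrow> bool" where
  "leaf G v \<longleftrightarrow> v \<in> verts G \<and> degree G v = 1"

definition delete_vertex :: "'a ugraph \<Rightarrow> 'a \<Rightarrow> 'a ugraph" where
  "delete_vertex G v = \<lparr>verts = verts G - {v}, edges = {e \<in> edges G. v \<notin> e}\<rparr>"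

definition delete_edge :: "'a ugraph \<Rightarrow> 'a set \<Rightarrow> 'a ugraph" where
  "delete_edge G e = \<lparr>verts = verts G, edges = edges G - {e}\<rparr>"

text \<open>
  Only newly isolated vertices count. On a graph without isolated vertices, and hence
  on every position reached from such a graph, this just says that \<open>H\<close> has an
  isolated vertex.
\<close>

definition creates_isolated :: "'a ugraph \<Rightarrow> 'a ugraph \<Rightarrow> bool" where
  "creates_isolated G H \<longleftrightarrow> (\<exists>u. isolated H u \<and> \<not> isolated G u)"

datatype player = Left | Right

fun opponent :: "player \<Rightarrow> player" where
  "opponent Left = Right"
| "opponent Right = Left"

datatype variant = Classic | Forbidden_Leaf

inductive legal_move :: "variant \<Rightarrow> player \<Rightarrow> 'a ugraph \<Rightarrow> 'a ugraph \<Rightarrow> bool"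
  for r :: variant where
  vertex_deletion:
    "\<lbrakk>v \<in> verts G; r = Forbidden_Leaf \<longrightarrow> \<not> leaf G v;
      \<not> creates_isolated G (delete_vertex G v)\<rbrakk>
     \<Longrightarrow> legal_move r Left G (delete_vertex G v)"
| edge_deletion:
    "\<lbrakk>e \<in> edges G; \<not> creates_isolated G (delete_edge G e)\<rbrakk>
     \<Longrightarrow> legal_move r Right G (delete_edge G e)"

text \<open>
  \<open>wins r p q G\<close>: under the rules \<open>r\<close>, player \<open>p\<close> has a winning strategy from
  position \<open>G\<close> when \<open>q\<close> is the player to move. By the second rule \<open>p\<close> wins
  at once if it is the opponent's turn and the opponent has no legal move; \<open>p\<close> loses
  if it is \<open>p\<close>'s own turn and \<open>p\<close> has none, since then no rule applies.
\<close>

inductive wins :: "variant \<Rightarrow> player \<Rightarrow> player \<Rightarrow> 'a ugraph \<Rightarrow> bool"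
  for r :: variant and p :: player where
  own_turn:
    "\<lbrakk>legal_move r p G H; wins r p (opponent p) H\<rbrakk> \<Longrightarrow> wins r p p G"
| opponent_turn:
    "(\<And>H. legal_move r (opponent p) G H \<Longrightarrow> wins r p p H) \<Longrightarrow> wins r p (opponent p) G"

definition path_graph :: "nat \<Rightarrow> nat ugraph" where
  "path_graph n = \<lparr>verts = {..<n}, edges = {{i, Suc i} | i. Suc i < n}\<rparr>"

lemma finite_simple_graph_path_graph: "finite_simple_graph (path_graph n)"
  by (auto simp: finite_simple_graph_def path_graph_def)

lemma finite_simple_graph_legal_move:
  "legal_move r p G H \<Longrightarrow> finite_simple_graph G \<Longrightarrow> finite_simple_graph H"
  by (induction rule: legal_move.induct)
     (auto simp: finite_simple_graph_def delete_vertex_def delete_edge_def)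

end

(* A position is a disjoint union of paths, and its outcome depends only on the multiset of their
   lengths: Left replaces a length i + j + 1 by i and j, Right replaces i + j by i and j, where
   i, j >= 2. If Right wins A and B as second player, he also wins their union, by answering in
   the component Left has moved in; if he wins A as first and B as second player, he wins the
   union as first player. Right wins every single path of length >= 4 as first player. As second
   player he loses only the lengths 5, 6, 7 and 11. Hence, by induction on n, every move of Left
   on P_n leaves a position that Right wins as first player, unless both parts have exceptional
   length; those finitely many pairs are handled by splitting off a path of length 4, which is a
   spare move for Right that Left cannot touch. *)

theory Submission
  imports Defs "HOL-Library.Multiset" "HOL-Library.Disjoint_Sets"
begin

section \<open>The game on multisets of path lengths\<close>

text \<open>Left's moves are the splits with \<open>d = 1\<close>, Right's those with \<open>d = 0\<close>.\<close>

definition splits :: "nat \<Rightarrow> nat multiset \<Rightarrow> nat multiset \<Rightarrow> bool" where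
  "splits d M N \<longleftrightarrow>
     (\<exists>i j A. 2 \<le> i \<and> 2 \<le> j \<and> M = add_mset (i + j + d) A \<and> N = add_mset i (add_mset j A))"

text \<open>A whole round, Left's move with Right's reply, forms one rule, so rule induction runs
  over rounds. Its base case is a position in which Left cannot move.\<close>

inductive wins_second :: "nat multiset \<Rightarrow> bool" where
  "(\<And>N. splits 1 M N \<Longrightarrow> \<exists>N'. splits 0 N N' \<and> wins_second N') \<Longrightarrow> wins_second M"

definition wins_first :: "nat multiset \<Rightarrow> bool" where
  "wins_first M \<longleftrightarrow> (\<exists>N. splits 0 M N \<and> wins_second N)"

lemma wins_secondI: "(\<And>N. splits 1 M N \<Longrightarrow> wins_first N) \<Longrightarrow> wins_second M"
  unfolding wins_first_def by (rule wins_second.intros)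

lemma splits_add: "splits d M N \<Longrightarrow> splits d (M + K) (N + K)"
  unfolding splits_def by (metis union_mset_add_mset_left)

lemma splits_union_cases:
  assumes "splits d (A + B) N"
  obtains A' where "splits d A A'" "N = A' + B" | B' where "splits d B B'" "N = A + B'"
proof -
  from assms obtain i j C where ij: "2 \<le> i" "2 \<le> j" and
    C: "A + B = add_mset (i + j + d) C" and N: "N = add_mset i (add_mset j C)"
    unfolding splits_def by blast
  have "i + j + d \<in># A + B" by (simp add: C)
  then consider "i + j + d \<in># A" | "i + j + d \<in># B" by auto
  then show thesis
  proof cases
    case 1
    then obtain D where D: "A = add_mset (i + j + d) D" by (meson mset_add)
    then have "C = D + B" using C by simp
    then show thesis using that(1)[of "add_mset i (add_mset j D)"] ij D N
      unfolding splits_def by auto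
  next
    case 2
    then obtain D where D: "B = add_mset (i + j + d) D" by (meson mset_add)
    then have "C = A + D" using C by simp
    then show thesis using that(2)[of "add_mset i (add_mset j D)"] ij D N
      unfolding splits_def by auto
  qed
qed

text \<open>Nested rule induction: the outer hypothesis, with \<open>B\<close> arbitrary, handles a
  Left move in \<open>A\<close>; the inner one, with \<open>A\<close> fixed, handles a move in
  \<open>B\<close>.\<close>

lemma wins_second_union: "wins_second A \<Longrightarrow> wins_second B \<Longrightarrow> wins_second (A + B)"
proof (induction A arbitrary: B rule: wins_second.induct)
  case (1 A)
  note IH_A = this(1)
  from \<open>wins_second B\<close> show ?case
  proof (induction B rule: wins_second.induct)
    case (1 B)
    have B: "wins_second B" using 1 by (meson wins_second.intros)
    show ?case
    proof (rule wins_second.intros)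
      fix N assume "splits 1 (A + B) N"
      then show "\<exists>N'. splits 0 N N' \<and> wins_second N'"
      proof (cases rule: splits_union_cases)
        case (1 A')
        then show ?thesis using IH_A B splits_add by blast
      next
        case (2 B')
        then show ?thesis using "1.IH" splits_add[of 0 B' _ A] by (metis add.commute)
      qed
    qed
  qed
qed

lemma wins_first_union: "wins_first A \<Longrightarrow> wins_second B \<Longrightarrow> wins_first (A + B)"
  unfolding wins_first_def using splits_add wins_second_union by blast

lemma wins_first_add_mset: "wins_second {#k#} \<Longrightarrow> wins_first A \<Longrightarrow> wins_first (add_mset k A)"
  using wins_first_union[of A "{#k#}"] by simp

lemma wins_firstI:
  "2 \<le> i \<Longrightarrow> 2 \<le> j \<Longrightarrow> k = i + j \<Longrightarrow> wins_second (add_mset i (add_mset j A))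
    \<Longrightarrow> wins_first (add_mset k A)"
  unfolding wins_first_def splits_def by auto

text \<open>Left can only split lengths of at least 2 + 1 + 2 = 5, so here she has no move.\<close>

lemma wins_second_small:
  assumes "\<forall>k \<in># M. k \<le> 4"
  shows "wins_second M"
proof (rule wins_secondI)
  fix N assume "splits 1 M N"
  then show "wins_first N" using assms unfolding splits_def by fastforce
qed

section \<open>The exceptional lengths\<close>

text \<open>
  Right always reduces the number of lengths \<open>5\<close>, \<open>6\<close>, \<open>7\<close> by one in his turn, as Left does in hers;
  the \<open>4\<close> is the spare move Right needs when Left takes the last of them.
\<close>

lemma wins_second_four_add:
  assumes "set_mset H \<subseteq> {5, 6, 7}"
  shows "wins_second (add_mset 4 H)"
  using assms
proof (induction "size H" arbitrary: H rule: less_induct)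
  case less
  show ?case
  proof (rule wins_secondI)
    fix N assume "splits 1 (add_mset 4 H) N"
    then obtain i j A where ij: "2 \<le> i" "2 \<le> j" and
      A: "add_mset 4 H = add_mset (i + j + 1) A" and N: "N = add_mset i (add_mset j A)"
      unfolding splits_def by blast
    then obtain H' where H': "H = add_mset (i + j + 1) H'" "A = add_mset 4 H'"
      by (auto simp: add_eq_conv_ex)
    have "i + j + 1 \<in> {5, 6, 7}" using less.prems H' by auto
    \<comment> \<open>As \<open>i + j\<close> is at most 6, both parts are at most 4 and dead for
      Left, so Right's reply can be sought in \<open>A\<close> alone.\<close>
    then have small: "wins_second {#i#}" "wins_second {#j#}"
      using ij by (auto intro!: wins_second_small)
    have "wins_first A"
    proof (cases "H' = {#}")
      case True
      then show ?thesis using H' by (auto intro!: wins_firstI[of 2 2] wins_second_small)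
    next
      case False
      then obtain h H'' where H'': "H' = add_mset h H''" by (meson multiset_cases)
      then have h: "h \<in> {5, 6, 7}" using less.prems H' by auto
      then obtain p q where pq: "h = p + q" "p \<in> {2, 3, 4}" "q \<in> {2, 3, 4}"
        by (cases "h = 5"; cases "h = 6") force+
      have "wins_second (add_mset 4 H'')"
        using less.hyps[of H''] less.prems H' H'' by auto
      then have "wins_second ({#p, q#} + add_mset 4 H'')"
        using pq by (intro wins_second_union wins_second_small[of "{#p, q#}"]) auto
      then have "wins_second (add_mset p (add_mset q (add_mset 4 H'')))"
        by (simp only: union_mset_add_mset_left add_0)
      then have "wins_first (add_mset h (add_mset 4 H''))"
        using pq by (intro wins_firstI[of p q]) auto
      then show ?thesis by (simp add: H' H'' add_mset_commute)
    qed
    then show "wins_first N"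
      unfolding N by (intro wins_first_add_mset[OF small(1)] wins_first_add_mset[OF small(2)])
  qed
qed

text \<open>Lengths 4 to 8 split into two parts that are dead for Left; 9 = 4 + 5 and 11 = 4 + 7
  give the spare 4 next to one exceptional length.\<close>

lemma wins_first_small:
  assumes "4 \<le> k" "k \<le> 9 \<or> k = 11"
  shows "wins_first {#k#}"
proof -
  have "k \<in> {4, 5, 6, 7, 8, 9, 11}" using assms by auto
  then obtain p q where "k = p + q" "p = 4 \<and> q \<in> {5, 7} \<or> p \<in> {2, 3, 4} \<and> q \<in> {2, 3, 4}"
    by (elim insertE; force)
  then show ?thesis
    using wins_second_four_add[of "{#q#}"] wins_second_small[of "{#p, q#}"]
    by (intro wins_firstI[of p q]) auto
qed

lemma add_eq_ten:
  fixes i j :: nat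
  assumes "i + j = 10" "2 \<le> i" "2 \<le> j"
  shows "(i, j) \<in> {(2,8), (3,7), (4,6), (5,5), (6,4), (7,3), (8,2)}"
proof -
  have "i \<in> {2,3,4,5,6,7,8}" using assms by auto
  then show ?thesis using assms by auto
qed

text \<open>This is Right's target when Left cuts a path of length 23 into 11 and 11. If Left splits
  the 7, Right turns the 11 into 4 and 7; if she splits the 11, the pair \<open>{#4, 7#}\<close>
  stays available as a component safe for Right.\<close>

lemma wins_second_four_seven_eleven: "wins_second {#4, 7, 11#}"
proof (rule wins_secondI)
  have four_seven: "wins_second {#4, 7#}" by (rule wins_second_four_add) simp
  fix N assume "splits 1 {#4, 7, 11#} N"
  then obtain i j A where ij: "2 \<le> i" "2 \<le> j" and
    A: "add_mset (i + j + 1) A = {#4, 7, 11#}" and N: "N = add_mset i (add_mset j A)"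
    unfolding splits_def by metis
  have "i + j + 1 \<in># {#4, 7, 11#}" using A by (metis union_single_eq_member)
  then consider "i + j = 6" | "i + j = 10" using ij by fastforce
  then show "wins_first N"
  proof cases
    case 1
    then have "A = {#4, 11#}" using A by (simp add: add_mset_commute)
    moreover have "wins_first {#11, 4#}"
      using wins_second_union[OF wins_second_small[of "{#4#}"] four_seven]
      by (intro wins_firstI[of 4 7]) (auto simp: add_mset_commute)
    ultimately show ?thesis unfolding N using ij 1
      by (intro wins_first_add_mset[of i] wins_first_add_mset[of j] wins_second_small)
        (auto simp: add_mset_commute)
  next
    case 2
    have A: "A = {#4, 7#}" using A 2 by (simp add: add_mset_commute)
    have *: "wins_first {#i, j, 4, 7#}"
      if "(i, j) \<in> {(2, 8), (3, 7), (4, 6), (5, 5)}" for i j :: nat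
    proof -
      show ?thesis
      \<comment> \<open>For \<open>i\<close> at most 4 that part is dead for Left and Right moves in
        \<open>j\<close>. Against two 5s he splits one into 2 and 3, so that the rest has the form
        of \<open>wins_second_four_add\<close>.\<close>
      proof (cases "i = 5")
        case True
        have "wins_second ({#2, 3#} + {#4, 5, 7#})"
          by (intro wins_second_union wins_second_four_add wins_second_small) auto
        then show ?thesis using that True
          by (intro wins_firstI[of 2 3]) (auto simp: add_mset_commute)
      next
        case False
        then have "wins_second {#i#}" "wins_first {#j#}"
          using that wins_second_small[of "{#i#}"] wins_first_small[of j] by auto
        then show ?thesis
          using wins_first_add_mset[OF _ wins_first_union[OF _ four_seven], of i "{#j#}"]
          by (simp only: union_mset_add_mset_left add_0)
      qed
    qed
    have "(i, j) \<in> {(2, 8), (3, 7), (4, 6), (5, 5)} \<or> (j, i) \<in> {(2, 8), (3, 7), (4, 6), (5, 5)}"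
      using add_eq_ten[OF 2 ij] by auto
    then show ?thesis using *[of i j] *[of j i] unfolding N A by (metis add_mset_commute)
  qed
qed

text \<open>Right releases a spare 4 by 6 = 2 + 4, 7 = 3 + 4 or 11 = 4 + 7. A 5 contains no such 4:
  from two 5s Right must leave 2, 3, 5, and Left's split of the last 5 ends his moves.\<close>

lemma wins_first_exceptional:
  assumes "i \<in> {5, 6, 7, 11}" "j \<in> {5, 6, 7, 11}" "\<not> (i = 5 \<and> j = 5)"
  shows "wins_first {#i, j#}"
proof -
  have hot: "wins_first {#i, j#}" if "i \<in> {6, 7}" "j \<in> {5, 6, 7}" for i j :: nat
  proof -
    have "wins_second ({#i - 4#} + {#4, j#})"
      using that by (intro wins_second_union wins_second_four_add wins_second_small) auto
    then have "wins_second {#i - 4, 4, j#}" by (simp only: union_mset_add_mset_left add_0)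
    then show ?thesis using that by (intro wins_firstI[of "i - 4" 4]) auto
  qed
  have eleven: "wins_first {#11, j#}" if "j \<in> {5, 6, 7, 11}" for j :: nat
  proof -
    have "wins_second {#4, 7, j#}"
      using that wins_second_four_add[of "{#7, j#}"] wins_second_four_seven_eleven by auto
    then show ?thesis by (intro wins_firstI[of 4 7]) auto
  qed
  show ?thesis
    using assms hot[of i j] hot[of j i] eleven[of i] eleven[of j]
    by (auto simp: add_mset_commute)
qed

section \<open>Single paths of arbitrary length\<close>

lemma wins_first_singleton_step:
  assumes "4 \<le> k" and smaller: "\<And>m. m < k \<Longrightarrow> 8 \<le> m \<Longrightarrow> m \<noteq> 11 \<Longrightarrow> wins_second {#m#}"
  shows "wins_first {#k#}"
proof (cases "k \<le> 9 \<or> k = 11")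
  case True
  then show ?thesis using wins_first_small assms by blast
next
  case False
  \<comment> \<open>Cutting off 2 fails only if it leaves 11, that is for \<open>k = 13\<close>;
    there 3 is cut off and 10 remains.\<close>
  define p :: nat where "p = (if k = 13 then 3 else 2)"
  have "wins_second ({#p#} + {#k - p#})"
    using False by (intro wins_second_union smaller wins_second_small[of "{#p#}"]) (auto simp: p_def)
  then show ?thesis using False
    by (intro wins_firstI[of p "k - p"]) (auto simp: p_def add_mset_commute)
qed

lemma wins_second_singleton:
  assumes "8 \<le> n" "n \<noteq> 11"
  shows "wins_second {#n#}"
  using assms
proof (induction n rule: less_induct)
  case (less n)
  have second: "wins_second {#k#}" if "k < n" "k \<notin> {5, 6, 7, 11}" for k
    using that less.IH[of k] by (cases "k \<le> 4") (auto intro: wins_second_small)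
  have first: "wins_first {#k#}" if "k < n" "4 \<le> k" for k
    using that less.IH by (intro wins_first_singleton_step) auto
  show ?case
  proof (rule wins_secondI)
    fix N assume "splits 1 {#n#} N"
    then obtain i j where ij: "2 \<le> i" "2 \<le> j" "n = i + j + 1" and N: "N = {#i, j#}"
      unfolding splits_def by auto
    \<comment> \<open>The parts sum to at least 7, so one of them is at least 4 and gives Right a
      move. If \<open>i\<close> is ordinary but \<open>j\<close> is at most 3, the second case
      applies.\<close>
    consider "i \<notin> {5, 6, 7, 11}" "4 \<le> j" | "j \<notin> {5, 6, 7, 11}" "4 \<le> i"
      | "i \<in> {5, 6, 7, 11}" "j \<in> {5, 6, 7, 11}"
      using ij less.prems by fastforce
    then show "wins_first N"
    proof cases
      case 1
      then show ?thesis unfolding N using ij by (intro wins_first_add_mset[of i] second first) auto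
    next
      case 2
      then have "wins_first {#j, i#}" using ij by (intro wins_first_add_mset[of j] second first) auto
      then show ?thesis by (simp add: N add_mset_commute)
    next
      case 3
      then show ?thesis unfolding N using ij less.prems by (intro wins_first_exceptional) auto
    qed
  qed
qed

lemma wins_first_singleton: "4 \<le> n \<Longrightarrow> wins_first {#n#}"
  by (intro wins_first_singleton_step wins_second_singleton)

section \<open>Linear forests\<close>

text \<open>A pair \<open>(a, k)\<close> stands for the path on the vertices \<open>a, \<dots>, a + k - 1\<close>.\<close>

fun span :: "nat \<times> nat \<Rightarrow> nat set" where
  "span (a, k) = {a..<a + k}"

fun span_edges :: "nat \<times> nat \<Rightarrow> nat set set" where
  "span_edges (a, k) = {{x, Suc x} | x. a \<le> x \<and> Suc x < a + k}"

definition forest_of :: "(nat \<times> nat) set \<Rightarrow> nat ugraph" where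
  "forest_of S = \<lparr>verts = \<Union> (span ` S), edges = \<Union> (span_edges ` S)\<rparr>"

text \<open>Disjoint intervals may be adjacent: edges come only from within an interval, so a
  deleted edge needs no renaming of vertices. The bound 2 excludes isolated vertices.\<close>

definition forest_spans :: "(nat \<times> nat) set \<Rightarrow> bool" where
  "forest_spans S \<longleftrightarrow> finite S \<and> (\<forall>s \<in> S. 2 \<le> snd s) \<and> disjoint_family_on span S"

definition lengths :: "(nat \<times> nat) set \<Rightarrow> nat multiset" where
  "lengths S = image_mset snd (mset_set S)"

definition split_span :: "(nat \<times> nat) set \<Rightarrow> nat \<Rightarrow> nat \<Rightarrow> nat \<Rightarrow> nat \<Rightarrow> (nat \<times> nat) set" where
  "split_span S a i j d = insert (a, i) (insert (a + i + d, j) (S - {(a, i + j + d)}))"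

lemma Suc_pair_eq_iff: "{x, Suc x} = {y, Suc y} \<longleftrightarrow> x = y"
  by (auto simp: doubleton_eq_iff)

lemma span_edges_subset: "e \<in> span_edges s \<Longrightarrow> e \<subseteq> span s"
  by (cases s) auto

lemma forest_of_insert:
  "forest_of (insert s S)
    = \<lparr>verts = span s \<union> verts (forest_of S), edges = span_edges s \<union> edges (forest_of S)\<rparr>"
  by (simp add: forest_of_def)

lemma edges_forest_of_subset: "e \<in> edges (forest_of S) \<Longrightarrow> e \<subseteq> verts (forest_of S)"
  using span_edges_subset unfolding forest_of_def by simp blast

lemma incident_edges_forest_of:
  assumes "forest_spans S" "s \<in> S" "v \<in> span s"
  shows "{e \<in> edges (forest_of S). v \<in> e} = {e \<in> span_edges s. v \<in> e}"
proof -
  have "t = s" if "t \<in> S" "e \<in> span_edges t" "v \<in> e" for t e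
  proof -
    have "v \<in> span t" using span_edges_subset[OF that(2)] that(3) by blast
    then show ?thesis
      using assms that(1) unfolding forest_spans_def disjoint_family_on_def by blast
  qed
  then show ?thesis using assms(2) unfolding forest_of_def by auto
qed

lemma degree_forest_of:
  assumes "forest_spans S" "(a, k) \<in> S" "v \<in> span (a, k)"
  shows "degree (forest_of S) v = (if v = a \<or> v = a + k - 1 then 1 else 2)"
proof -
  have k: "2 \<le> k" using assms unfolding forest_spans_def by force
  have "{e \<in> span_edges (a, k). v \<in> e} =
      (if v = a then {{a, Suc a}} else if v = a + k - 1 then {{v - 1, v}}
       else {{v - 1, v}, {v, Suc v}})"
    using assms(3) k by (auto simp: doubleton_eq_iff)
  then show ?thesis
    using assms(3) k incident_edges_forest_of[OF assms]
    by (auto simp: degree_def doubleton_eq_iff)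
qed

lemma not_isolated_forest_of:
  assumes "forest_spans S"
  shows "\<not> isolated (forest_of S) v"
proof
  assume v: "isolated (forest_of S) v"
  then obtain a k where "(a, k) \<in> S" "v \<in> span (a, k)"
    unfolding isolated_def forest_of_def by auto
  then show False using v degree_forest_of[OF assms] unfolding isolated_def by (auto split: if_splits)
qed

section \<open>Effect of one split on the represented graph\<close>

context
  fixes S :: "(nat \<times> nat) set" and a i j d :: nat
  assumes S: "forest_spans S" and mem: "(a, i + j + d) \<in> S" and ij: "2 \<le> i" "2 \<le> j"
begin

lemma new_spans_disjoint:
  assumes "t \<in> S - {(a, i + j + d)}"
  shows "span (a, i) \<inter> span t = {}" "span (a + i + d, j) \<inter> span t = {}"
proof -
  have "span (a, i + j + d) \<inter> span t = {}"
    using assms S mem unfolding forest_spans_def disjoint_family_on_def by blast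
  moreover have "span (a, i) \<subseteq> span (a, i + j + d)" "span (a + i + d, j) \<subseteq> span (a, i + j + d)"
    by auto
  ultimately show "span (a, i) \<inter> span t = {}" "span (a + i + d, j) \<inter> span t = {}" by blast+
qed

text \<open>Without this, a new pair could coincide with a pair already in the set, and
  \<open>lengths\<close> would lose a path.\<close>

lemma new_spans_notin:
  "(a + i + d, j) \<notin> S - {(a, i + j + d)}"
  "(a, i) \<notin> insert (a + i + d, j) (S - {(a, i + j + d)})"
  using new_spans_disjoint[of "(a, i)"] new_spans_disjoint[of "(a + i + d, j)"] ij by auto

lemma forest_spans_split_span: "forest_spans (split_span S a i j d)"
proof -
  have "span (a, i) \<inter> span (a + i + d, j) = {}" by auto
  moreover have "disjoint_family_on span (S - {(a, i + j + d)})"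
    using S unfolding forest_spans_def disjoint_family_on_def by blast
  ultimately have "disjoint_family_on span (split_span S a i j d)"
    using new_spans_disjoint new_spans_notin unfolding split_span_def
    by (simp add: disjoint_family_on_insert del: span.simps) blast
  then show ?thesis using S ij unfolding forest_spans_def split_span_def by auto
qed

lemma splits_lengths: "splits d (lengths S) (lengths (split_span S a i j d))"
proof -
  have fin: "finite S" using S unfolding forest_spans_def by blast
  have "lengths S = add_mset (i + j + d) (lengths (S - {(a, i + j + d)}))"
    unfolding lengths_def using mem fin by (subst mset_set.remove[OF fin mem]) simp
  moreover have "lengths (split_span S a i j d)
      = add_mset i (add_mset j (lengths (S - {(a, i + j + d)})))"
    unfolding lengths_def split_span_def using fin new_spans_notin by simp
  ultimately show ?thesis unfolding splits_def using ij by blast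
qed

text \<open>The same vertex serves both players: \<open>a + i\<close> is deleted if
  \<open>d = 1\<close> and is the upper end of the deleted edge if \<open>d = 0\<close>. Hence the
  other paths stay untouched.\<close>

lemma split_point_notin: "a + i \<notin> verts (forest_of (S - {(a, i + j + d)}))"
proof -
  have "a + i \<notin> span t" if "t \<in> S - {(a, i + j + d)}" for t
  proof -
    have "span (a, i + j + d) \<inter> span t = {}"
      using that S mem unfolding forest_spans_def disjoint_family_on_def by blast
    moreover have "a + i \<in> span (a, i + j + d)" using ij by simp
    ultimately show ?thesis by blast
  qed
  then show ?thesis unfolding forest_of_def by simp
qed

lemma delete_vertex_forest_of:
  assumes "d = 1"
  shows "delete_vertex (forest_of S) (a + i) = forest_of (split_span S a i j d)"
proof -
  define S' where "S' = S - {(a, i + j + d)}"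
  have rest: "a + i \<notin> verts (forest_of S')" unfolding S'_def by (rule split_point_notin)
  have S_eq: "S = insert (a, i + j + d) S'" using mem S'_def by blast
  have "span (a, i + j + d) - {a + i} = span (a, i) \<union> span (a + i + d, j)"
    using assms by auto
  moreover have "{e \<in> span_edges (a, i + j + d). a + i \<notin> e}
      = span_edges (a, i) \<union> span_edges (a + i + d, j)"
    using assms by (auto simp: Suc_pair_eq_iff)
  moreover have "{e \<in> edges (forest_of S'). a + i \<notin> e} = edges (forest_of S')"
    using rest edges_forest_of_subset by blast
  moreover have "verts (forest_of S') - {a + i} = verts (forest_of S')" using rest by blast
  ultimately show ?thesis
    unfolding delete_vertex_def split_span_def S'_def[symmetric]
    by (subst (1 2) S_eq)
      (simp add: forest_of_insert Un_Diff Un_assoc Collect_disj_eq conj_disj_distribR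
        del: span.simps span_edges.simps)
qed

lemma delete_edge_forest_of:
  assumes "d = 0"
  shows "delete_edge (forest_of S) {a + i - 1, a + i} = forest_of (split_span S a i j d)"
    and "{a + i - 1, a + i} \<in> edges (forest_of S)"
proof -
  let ?e = "{a + i - 1, a + i}"
  \<comment> \<open>The subtraction is not truncated because \<open>i\<close> is at least 2.\<close>
  have e: "?e = {a + i - 1, Suc (a + i - 1)}" using ij by auto
  define S' where "S' = S - {(a, i + j + d)}"
  have rest: "a + i \<notin> verts (forest_of S')" unfolding S'_def by (rule split_point_notin)
  have S_eq: "S = insert (a, i + j + d) S'" using mem S'_def by blast
  have "edges (forest_of S') - {?e} = edges (forest_of S')"
    using rest edges_forest_of_subset by blast
  moreover have "span (a, i + j + d) = span (a, i) \<union> span (a + i + d, j)"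
    using assms by auto
  moreover have "span_edges (a, i + j + d) - {?e}
      = span_edges (a, i) \<union> span_edges (a + i + d, j)"
    unfolding e using assms ij by (auto simp: Suc_pair_eq_iff simp del: Suc_pred)
  ultimately show "delete_edge (forest_of S) ?e = forest_of (split_span S a i j d)"
    unfolding delete_edge_def split_span_def S'_def[symmetric]
    by (subst (1 2) S_eq)
      (simp add: forest_of_insert Un_Diff Un_assoc del: span.simps span_edges.simps)
  have "?e \<in> span_edges (a, i + j + d)"
    unfolding e using ij assms by (auto simp: Suc_pair_eq_iff simp del: Suc_pred)
  then show "?e \<in> edges (forest_of S)"
    using mem unfolding forest_of_def by (auto simp del: span_edges.simps)
qed

end

section \<open>Transfer of moves and strategies to graphs\<close>

lemma left_move_forest_of:
  assumes S: "forest_spans S" and move: "legal_move Forbidden_Leaf Left (forest_of S) H"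
  obtains T where "H = forest_of T" "forest_spans T" "splits 1 (lengths S) (lengths T)"
  using move
proof cases
  case (vertex_deletion v)
  then obtain a k where ak: "(a, k) \<in> S" "v \<in> span (a, k)" by (auto simp: forest_of_def)
  have k: "2 \<le> k" using ak S unfolding forest_spans_def by force
  \<comment> \<open>The ends of a path are leaves, which Left may not delete in this
    variant.\<close>
  have inner: "v \<noteq> a" "v \<noteq> a + k - 1"
    using vertex_deletion degree_forest_of[OF S ak] by (auto simp: leaf_def)
  have alive: "\<exists>e \<in> span_edges (a, k). u \<in> e \<and> v \<notin> e" if u: "u \<in> span (a, k)" "u \<noteq> v" for u
  proof (rule ccontr)
    assume none: "\<not> ?thesis"
    have "{e \<in> edges H. u \<in> e} = {e \<in> {e \<in> edges (forest_of S). u \<in> e}. v \<notin> e}"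
      using vertex_deletion(1) unfolding delete_vertex_def by auto
    also have "\<dots> = {}"
      unfolding incident_edges_forest_of[OF S ak(1) u(1)] using none by blast
    finally have "degree H u = 0" unfolding degree_def by (simp only: card.empty)
    moreover have "u \<in> verts H"
      using u ak vertex_deletion(1) unfolding delete_vertex_def forest_of_def
      by (auto simp del: span.simps)
    ultimately show False
      using vertex_deletion not_isolated_forest_of[OF S] unfolding creates_isolated_def isolated_def
      by blast
  qed
  define i where "i = v - a"
  define j where "j = a + k - 1 - v"
  \<comment> \<open>An end of the path has a single edge, so deleting its neighbour would isolate
    it. Thus both remaining pieces have at least 2 vertices.\<close>
  have "v \<noteq> a + 1" using alive[of a] k inner by fastforce
  moreover have "v \<noteq> a + k - 2" using alive[of "a + k - 1"] k inner by fastforce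
  ultimately have ij: "2 \<le> i" "2 \<le> j" "k = i + j + 1" "v = a + i"
    using ak(2) inner unfolding i_def j_def by auto
  then have "(a, i + j + 1) \<in> S" using ak(1) by simp
  note split = S this ij(1,2)
  show ?thesis
  proof (rule that)
    show "H = forest_of (split_span S a i j 1)"
      using delete_vertex_forest_of[OF split] vertex_deletion(1) ij(4) by simp
  qed (fact forest_spans_split_span[OF split] splits_lengths[OF split])+
qed

text \<open>The converse direction to Left's case: her every legal move must be a split, whereas for
  Right each split that his strategy asks for must be realised by a legal move.\<close>

lemma right_move_forest_of:
  assumes S: "forest_spans S" and "splits 0 (lengths S) N"
  obtains T where "legal_move Forbidden_Leaf Right (forest_of S) (forest_of T)"
    "forest_spans T" "lengths T = N"
proof -
  from assms obtain i j A where ij: "2 \<le> i" "2 \<le> j" and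
    A: "lengths S = add_mset (i + j + 0) A" and N: "N = add_mset i (add_mset j A)"
    unfolding splits_def by blast
  have "i + j + 0 \<in># lengths S" by (simp add: A)
  then obtain a where a: "(a, i + j + 0) \<in> S"
    using S unfolding lengths_def forest_spans_def by auto
  define T where "T = split_span S a i j 0"
  have T: "forest_spans T" unfolding T_def using forest_spans_split_span[OF S a ij] .
  have "lengths T = N"
  proof -
    have fin: "finite S" using S unfolding forest_spans_def by blast
    have "lengths S = add_mset (i + j + 0) (lengths (S - {(a, i + j + 0)}))"
      unfolding lengths_def by (subst mset_set.remove[OF fin a]) simp
    then have "A = lengths (S - {(a, i + j + 0)})" using A by simp
    then show ?thesis
      using fin new_spans_notin[OF S a ij] unfolding N T_def split_span_def lengths_def by simp
  qed
  moreover have "legal_move Forbidden_Leaf Right (forest_of S) (forest_of T)"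
    using legal_move.edge_deletion[of "{a + i - 1, a + i}" "forest_of S" Forbidden_Leaf]
      delete_edge_forest_of[OF S a ij] not_isolated_forest_of[OF T]
    unfolding T_def creates_isolated_def by simp
  ultimately show thesis using that T by blast
qed

lemma wins_second_forest_of:
  "wins_second M \<Longrightarrow> forest_spans S \<Longrightarrow> lengths S = M
    \<Longrightarrow> wins Forbidden_Leaf Right Left (forest_of S)"
proof (induction M arbitrary: S rule: wins_second.induct)
  case (1 M)
  have "wins Forbidden_Leaf Right Right H"
    if move: "legal_move Forbidden_Leaf Left (forest_of S) H" for H
  proof -
    obtain T where T: "H = forest_of T" "forest_spans T" "splits 1 M (lengths T)"
      using left_move_forest_of[OF \<open>forest_spans S\<close> move] \<open>lengths S = M\<close> by metis
    then obtain N where N: "splits 0 (lengths T) N"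
      "\<And>S. forest_spans S \<Longrightarrow> lengths S = N \<Longrightarrow> wins Forbidden_Leaf Right Left (forest_of S)"
      using "1.IH" by blast
    obtain U where "legal_move Forbidden_Leaf Right (forest_of T) (forest_of U)"
      "forest_spans U" "lengths U = N"
      using right_move_forest_of[OF T(2) N(1)] .
    then show ?thesis unfolding T(1) using wins.own_turn[of _ Right] N(2) by auto
  qed
  then show ?case using wins.opponent_turn[of _ Right] by auto
qed

lemma wins_first_forest_of:
  assumes "wins_first (lengths S)" "forest_spans S"
  shows "wins Forbidden_Leaf Right Right (forest_of S)"
proof -
  obtain N where N: "splits 0 (lengths S) N" "wins_second N"
    using assms unfolding wins_first_def by blast
  obtain U where "legal_move Forbidden_Leaf Right (forest_of S) (forest_of U)"
    "forest_spans U" "lengths U = N"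
    using right_move_forest_of[OF assms(2) N(1)] .
  then show ?thesis using wins.own_turn[of _ Right] wins_second_forest_of[OF N(2)] by auto
qed

theorem theorem3p11:
  fixes n :: nat
  assumes "n \<ge> 8" and "n \<noteq> 11"
  shows "\<forall>first. wins Forbidden_Leaf Right first (path_graph n)"
proof
  fix first
  have path: "path_graph n = forest_of {(0, n)}"
    by (auto simp: path_graph_def forest_of_def)
  have "forest_spans {(0, n)}" "lengths {(0, n)} = {#n#}"
    using assms by (auto simp: forest_spans_def lengths_def disjoint_family_on_def)
  then show "wins Forbidden_Leaf Right first (path_graph n)"
    unfolding path
    using wins_second_forest_of[OF wins_second_singleton[OF assms]] wins_first_singleton[of n] assms(1)
      wins_first_forest_of[of "{(0, n)}"]
    by (cases first) auto
qed

end
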